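(* Let $\mathfrak{g}$ be a finite-dimensional complex Lie algebra. The first cohomology space with adjoint coefficients of the semi-direct product $\mathfrak{g}\rtimes\mathfrak{g}$ is given, as a vector space, by $$H^1(\mathfrak{g}\rtimes\mathfrak{g},\mathfrak{g}\rtimes\mathfrak{g})\cong (H^1(\mathfrak{g},\mathfrak{g}))^{\oplus 2}\oplus\mathrm{Hom}(\mathfrak{g}/[\mathfrak{g},\mathfrak{g}],Z(\mathfrak{g}))\oplus\mathrm{Centr}(\mathfrak{g}).$$
   Context: The semi-direct product $\mathfrak{g}\rtimes\mathfrak{g}$ is the vector space $\mathfrak{g}\oplus\mathfrak{g}$ with bracket $[(m,g),(m',g')]=([g,m']-[g',m],[g,g'])$; that is, the first factor is viewed as the adjoint $\mathfrak{g}$-module and as an abelian Lie algebra. For a Lie algebra $\mathfrak{l}$, $H^1(\mathfrak{l},\mathfrak{l})$ is the first Chevalley-Eilenberg cohomology space with adjoint coefficients (derivations modulo inner derivations). $Z(\mathfrak{g})$ is the center of $\mathfrak{g}$, and $\mathrm{Hom}$ denotes linear maps of vector spaces. The centroid is the vector space of linear maps $\mathrm{Centr}(\mathfrak{g})=\{\varphi:\mathfrak{g}\to\mathfrak{g}\mid \varphi([x,y])=[x,\varphi(y)]\ \text{for all }x,y\in\mathfrak{g}\}$. *)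

theory Defs
  imports "HOL.Complex" "HOL-Algebra.AbelCoset" "Jordan_Normal_Form.VS_Connect"
begin

text \<open>
  Vector spaces are the carrier-based records of \<^locale>\<open>vectorspace\<close>; a subspace \<open>S\<close> of \<open>V\<close> is
  the record \<open>V\<lparr>carrier := S\<rparr>\<close>.  The fields \<open>mult\<close> and \<open>one\<close> of these records are
  irrelevant and are filled with dummies, as in \<^const>\<open>direct_sum\<close>.
\<close>

definition hom_space ::
  "('a, 'k) ring_scheme \<Rightarrow> ('a, 'v, 'm) module_scheme \<Rightarrow> ('a, 'w, 'n) module_scheme
    \<Rightarrow> ('a, 'v \<Rightarrow> 'w) module"
  where
  \<comment> \<open>The maps are extensional, so that two linear maps are equal as soon as they agree on
      \<open>carrier V\<close>.\<close>
  "hom_space K V W =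
    \<lparr>carrier = LinearCombinations.module_hom K V W \<inter> extensional (carrier V),
     mult = (\<lambda>f g. \<lambda>x\<in>carrier V. \<zero>\<^bsub>W\<^esub>),
     one = (\<lambda>x\<in>carrier V. \<zero>\<^bsub>W\<^esub>),
     zero = (\<lambda>x\<in>carrier V. \<zero>\<^bsub>W\<^esub>),
     add = (\<lambda>f g. \<lambda>x\<in>carrier V. f x \<oplus>\<^bsub>W\<^esub> g x),
     smult = (\<lambda>c f. \<lambda>x\<in>carrier V. c \<odot>\<^bsub>W\<^esub> f x)\<rparr>"

definition quot_space ::
  "('a, 'v, 'm) module_scheme \<Rightarrow> 'v set \<Rightarrow> ('a, 'v set) module"
  where
  "quot_space V W =
    \<lparr>carrier = a_rcosets\<^bsub>V\<^esub> W,
     mult = (\<lambda>A B. W),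
     one = W,
     zero = W,
     add = (\<lambda>A B. A <+>\<^bsub>V\<^esub> B),
     smult = (\<lambda>c A. \<Union>x\<in>A. W +>\<^bsub>V\<^esub> (c \<odot>\<^bsub>V\<^esub> x))\<rparr>"

definition vs_isomorphic ::
  "('a, 'k) ring_scheme \<Rightarrow> ('a, 'v, 'm) module_scheme \<Rightarrow> ('a, 'w, 'n) module_scheme \<Rightarrow> bool"
  where
  "vs_isomorphic K V W \<longleftrightarrow> (\<exists>T. linear_map K V W T \<and> bij_betw T (carrier V) (carrier W))"

locale lie_algebra = vectorspace K V
  for K :: "('a, 'k) ring_scheme" and V :: "('a, 'v, 'm) module_scheme" +
  fixes br :: "'v \<Rightarrow> 'v \<Rightarrow> 'v"
  assumes br_closed:
      "\<lbrakk>x \<in> carrier V; y \<in> carrier V\<rbrakk> \<Longrightarrow> br x y \<in> carrier V"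
    and br_add_left:
      "\<lbrakk>x \<in> carrier V; y \<in> carrier V; z \<in> carrier V\<rbrakk>
        \<Longrightarrow> br (x \<oplus>\<^bsub>V\<^esub> y) z = br x z \<oplus>\<^bsub>V\<^esub> br y z"
    and br_add_right:
      "\<lbrakk>x \<in> carrier V; y \<in> carrier V; z \<in> carrier V\<rbrakk>
        \<Longrightarrow> br x (y \<oplus>\<^bsub>V\<^esub> z) = br x y \<oplus>\<^bsub>V\<^esub> br x z"
    and br_smult_left:
      "\<lbrakk>c \<in> carrier K; x \<in> carrier V; y \<in> carrier V\<rbrakk>
        \<Longrightarrow> br (c \<odot>\<^bsub>V\<^esub> x) y = c \<odot>\<^bsub>V\<^esub> br x y"
    and br_smult_right:
      "\<lbrakk>c \<in> carrier K; x \<in> carrier V; y \<in> carrier V\<rbrakk>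
        \<Longrightarrow> br x (c \<odot>\<^bsub>V\<^esub> y) = c \<odot>\<^bsub>V\<^esub> br x y"
    and br_self: "x \<in> carrier V \<Longrightarrow> br x x = \<zero>\<^bsub>V\<^esub>"
    and jacobi:
      "\<lbrakk>x \<in> carrier V; y \<in> carrier V; z \<in> carrier V\<rbrakk>
        \<Longrightarrow> br x (br y z) \<oplus>\<^bsub>V\<^esub> br y (br z x) \<oplus>\<^bsub>V\<^esub> br z (br x y) = \<zero>\<^bsub>V\<^esub>"

text \<open>
  The underlying space of the semi-direct product is \<open>direct_sum V V\<close>; in \<open>(m, g)\<close> the
  component \<open>m\<close> belongs to the adjoint module.
\<close>
definition semidirect_br ::
  "('a, 'v, 'm) module_scheme \<Rightarrow> ('v \<Rightarrow> 'v \<Rightarrow> 'v) \<Rightarrow> 'v \<times> 'v \<Rightarrow> 'v \<times> 'v \<Rightarrow> 'v \<times> 'v"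
  where
  "semidirect_br V br = (\<lambda>(m, g) (m', g'). (br g m' \<ominus>\<^bsub>V\<^esub> br g' m, br g g'))"


definition derivations ::
  "('a, 'k) ring_scheme \<Rightarrow> ('a, 'v, 'm) module_scheme \<Rightarrow> ('v \<Rightarrow> 'v \<Rightarrow> 'v) \<Rightarrow> ('v \<Rightarrow> 'v) set"
  where
  "derivations K V br =
    {D \<in> carrier (hom_space K V V).
      \<forall>x\<in>carrier V. \<forall>y\<in>carrier V. D (br x y) = br (D x) y \<oplus>\<^bsub>V\<^esub> br x (D y)}"

definition inner_derivations ::
  "('a, 'v, 'm) module_scheme \<Rightarrow> ('v \<Rightarrow> 'v \<Rightarrow> 'v) \<Rightarrow> ('v \<Rightarrow> 'v) set"
  where
  "inner_derivations V br = (\<lambda>x. \<lambda>y\<in>carrier V. br x y) ` carrier V"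

definition H1_adjoint ::
  "('a, 'k) ring_scheme \<Rightarrow> ('a, 'v, 'm) module_scheme \<Rightarrow> ('v \<Rightarrow> 'v \<Rightarrow> 'v)
    \<Rightarrow> ('a, ('v \<Rightarrow> 'v) set) module"
  where
  "H1_adjoint K V br =
    quot_space ((hom_space K V V)\<lparr>carrier := derivations K V br\<rparr>) (inner_derivations V br)"

definition lie_center ::
  "('a, 'v, 'm) module_scheme \<Rightarrow> ('v \<Rightarrow> 'v \<Rightarrow> 'v) \<Rightarrow> 'v set"
  where
  "lie_center V br = {z \<in> carrier V. \<forall>x\<in>carrier V. br z x = \<zero>\<^bsub>V\<^esub>}"

definition derived_subspace ::
  "('a, 'k) ring_scheme \<Rightarrow> ('a, 'v, 'm) module_scheme \<Rightarrow> ('v \<Rightarrow> 'v \<Rightarrow> 'v) \<Rightarrow> 'v set"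
  where
  "derived_subspace K V br =
    LinearCombinations.module.span K V {br x y | x y. x \<in> carrier V \<and> y \<in> carrier V}"

definition centroid ::
  "('a, 'k) ring_scheme \<Rightarrow> ('a, 'v, 'm) module_scheme \<Rightarrow> ('v \<Rightarrow> 'v \<Rightarrow> 'v)
    \<Rightarrow> ('a, 'v \<Rightarrow> 'v) module"
  where
  "centroid K V br = (hom_space K V V)\<lparr>carrier :=
    {\<phi> \<in> carrier (hom_space K V V).
      \<forall>x\<in>carrier V. \<forall>y\<in>carrier V. \<phi> (br x y) = br x (\<phi> y)}\<rparr>"

end

theory Submission
  imports Defs
begin

text \<open>
  Split \<open>\<gg> \<oplus> \<gg>\<close> into its two summands and write a linear endomorphism of the semi-direct
  product as a block matrix, \<open>D (m, g) = (A m + B g, C m + E g)\<close>.  The Leibniz rule needs to be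
  tested only on pairs of vectors that each lie in one summand, and there it says:

  \<^item> on two vectors of the second summand: \<open>B\<close> and \<open>E\<close> are derivations of \<open>\<gg>\<close>;
  \<^item> on mixed pairs: \<open>A [g, m] = [E g, m] + [g, A m]\<close> and \<open>C [g, m] = [g, C m]\<close>;
  \<^item> on two vectors of the first summand: \<open>[C m, n] = [C n, m]\<close>.

  As \<open>E\<close> is a derivation, the condition on \<open>A\<close> says that \<open>A - E\<close> lies in the centroid.  The two
  conditions on \<open>C\<close> give \<open>2 C [m, n] = 0\<close>, so over a field in which \<open>2\<close> is invertible
  \<open>C\<close> vanishes on \<open>[\<gg>, \<gg>]\<close>; then \<open>[g, C m] = 0\<close>, that is, \<open>C\<close> takes central values.
  Conversely all such blocks give derivations, hence \<open>D \<mapsto> (B, E, C, A - E)\<close> identifies the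
  derivations of \<open>\<gg> \<rtimes> \<gg>\<close> with \<open>Der \<gg> \<oplus> Der \<gg> \<oplus> Hom (\<gg>/[\<gg>,\<gg>], Z \<gg>) \<oplus> Centr \<gg>\<close>
  (lemmas \<open>derivation_blocks\<close> and \<open>derivation_from_blocks\<close>).

  The inner derivation of \<open>(m, g)\<close> has the blocks \<open>A = E = ad g\<close>, \<open>B = ad m\<close> and \<open>C = 0\<close>
  (lemma \<open>inner_derivation_blocks\<close>), so the inner derivations correspond to
  \<open>ad \<gg> \<oplus> ad \<gg> \<oplus> 0 \<oplus> 0\<close>.  Composing with the projections \<open>Der \<gg> \<rightarrow> H\<^sup>1\<close> yields a linear
  surjection onto the right-hand side whose kernel is the space of inner derivations, and the first
  isomorphism theorem (\<open>quot_isomorphic\<close>) finishes the proof.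
\<close>

section \<open>Linear maps\<close>

lemma (in abelian_group) add_eq_zeroD:
  "x \<in> carrier G \<Longrightarrow> y \<in> carrier G \<Longrightarrow> x \<oplus> y = \<zero> \<Longrightarrow> x = \<ominus> y"
  using minus_equality by simp

lemma (in abelian_group) a_inv_zero: "\<ominus> \<zero> = \<zero>"
  by (rule minus_equality) simp_all

lemma (in vectorspace) subspaceI:
  assumes "W \<subseteq> carrier V" and "\<zero>\<^bsub>V\<^esub> \<in> W"
    and "\<And>v w. v \<in> W \<Longrightarrow> w \<in> W \<Longrightarrow> v \<oplus>\<^bsub>V\<^esub> w \<in> W"
    and "\<And>c v. c \<in> carrier K \<Longrightarrow> v \<in> W \<Longrightarrow> c \<odot>\<^bsub>V\<^esub> v \<in> W"
  shows "VectorSpace.subspace K W V"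
  using assms vectorspace_axioms module_axioms
  by (auto simp: VectorSpace.subspace_def LinearCombinations.submodule_def)

lemma (in vectorspace) double_eq_zeroD:
  assumes two: "\<one>\<^bsub>K\<^esub> \<oplus>\<^bsub>K\<^esub> \<one>\<^bsub>K\<^esub> \<noteq> \<zero>\<^bsub>K\<^esub>" and x: "x \<in> carrier V"
    and "x \<oplus>\<^bsub>V\<^esub> x = \<zero>\<^bsub>V\<^esub>"
  shows "x = \<zero>\<^bsub>V\<^esub>"
proof -
  have "(\<one>\<^bsub>K\<^esub> \<oplus>\<^bsub>K\<^esub> \<one>\<^bsub>K\<^esub>) \<odot>\<^bsub>V\<^esub> x = \<zero>\<^bsub>V\<^esub>"
    using assms(3) x by (simp add: smult_l_distr)
  then have "x = inv\<^bsub>K\<^esub> (\<one>\<^bsub>K\<^esub> \<oplus>\<^bsub>K\<^esub> \<one>\<^bsub>K\<^esub>) \<odot>\<^bsub>V\<^esub> \<zero>\<^bsub>V\<^esub>"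
    using two x by (intro mult_inverse) auto
  also have "\<dots> = \<zero>\<^bsub>V\<^esub>" using two by simp
  finally show ?thesis .
qed

lemma linear_mapI:
  assumes "vectorspace K V" and "vectorspace K X"
    and "\<And>x. x \<in> carrier V \<Longrightarrow> T x \<in> carrier X"
    and "\<And>x y. x \<in> carrier V \<Longrightarrow> y \<in> carrier V \<Longrightarrow> T (x \<oplus>\<^bsub>V\<^esub> y) = T x \<oplus>\<^bsub>X\<^esub> T y"
    and "\<And>c x. c \<in> carrier K \<Longrightarrow> x \<in> carrier V \<Longrightarrow> T (c \<odot>\<^bsub>V\<^esub> x) = c \<odot>\<^bsub>X\<^esub> T x"
  shows "linear_map K V X T"
proof -
  interpret V: vectorspace K V by fact
  interpret X: vectorspace K X by fact
  show ?thesis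
    by unfold_locales (use assms(3-) in \<open>auto simp: LinearCombinations.module_hom_def\<close>)
qed

lemma linear_map_Pair:
  assumes "linear_map K V X S" and "linear_map K V Y T"
  shows "linear_map K V (direct_sum X Y) (\<lambda>v. (S v, T v))"
proof -
  interpret S: linear_map K V X S by fact
  interpret T: linear_map K V Y T by fact
  show ?thesis
    by (rule linear_mapI[OF S.V.vectorspace_axioms
          direct_sum_is_vs[OF S.W.vectorspace_axioms T.W.vectorspace_axioms]])
       (auto simp: direct_sum_def)
qed

lemma linear_map_compose:
  assumes "linear_map K U V S" and "linear_map K V X T"
  shows "linear_map K U X (\<lambda>u. T (S u))"
proof -
  interpret S: linear_map K U V S by fact
  interpret T: linear_map K V X T by fact
  show ?thesis
    by (rule linear_mapI[OF S.V.vectorspace_axioms T.W.vectorspace_axioms]) auto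
qed

lemma linear_map_diff:
  assumes S: "linear_map K V X S" and T: "linear_map K V X T"
  shows "linear_map K V X (\<lambda>v. S v \<ominus>\<^bsub>X\<^esub> T v)"
proof -
  interpret X: vectorspace K X using S by (simp add: linear_map_def)
  interpret S: linear_map K V X S by fact
  interpret T: linear_map K V X T by fact
  show ?thesis
    by (rule linear_mapI[OF S.V.vectorspace_axioms X.vectorspace_axioms])
       (auto simp: X.module.M.minus_eq X.module.M.minus_add X.module.M.a_ac
         X.smult_r_distr X.smult_r_minus)
qed

lemma linear_map_restrict:
  assumes T: "linear_map K V X T" and W: "VectorSpace.subspace K W V"
    and Y: "VectorSpace.subspace K Y X" and sub: "\<And>w. w \<in> W \<Longrightarrow> T w \<in> Y"
  shows "linear_map K (V\<lparr>carrier := W\<rparr>) (X\<lparr>carrier := Y\<rparr>) T"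
proof -
  interpret T: linear_map K V X T by fact
  have "w \<in> carrier V" if "w \<in> W" for w
    using W that by (auto simp: VectorSpace.subspace_def LinearCombinations.submodule_def)
  then show ?thesis
    by (intro linear_mapI[OF T.V.subspace_is_vs[OF W] T.W.subspace_is_vs[OF Y]]) (auto simp: sub)
qed

lemma direct_sum_simps:
  "carrier (direct_sum V W) = carrier V \<times> carrier W"
  "\<zero>\<^bsub>direct_sum V W\<^esub> = (\<zero>\<^bsub>V\<^esub>, \<zero>\<^bsub>W\<^esub>)"
  "p \<oplus>\<^bsub>direct_sum V W\<^esub> q = (fst p \<oplus>\<^bsub>V\<^esub> fst q, snd p \<oplus>\<^bsub>W\<^esub> snd q)"
  "c \<odot>\<^bsub>direct_sum V W\<^esub> p = (c \<odot>\<^bsub>V\<^esub> fst p, c \<odot>\<^bsub>W\<^esub> snd p)"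
  by (simp_all add: direct_sum_def)

lemma (in vectorspace) fst_snd_linear:
  "linear_map K (direct_sum V V) V fst"
  "linear_map K (direct_sum V V) V snd"
  by (rule linear_mapI[OF direct_sum_is_vs[OF vectorspace_axioms vectorspace_axioms]
        vectorspace_axioms]; auto simp: direct_sum_def)+

lemma (in vectorspace) inclusions_linear:
  "linear_map K V (direct_sum V V) (\<lambda>x. (x, \<zero>\<^bsub>V\<^esub>))"
  "linear_map K V (direct_sum V V) (\<lambda>x. (\<zero>\<^bsub>V\<^esub>, x))"
  by (rule linear_mapI[OF vectorspace_axioms
        direct_sum_is_vs[OF vectorspace_axioms vectorspace_axioms]]; auto simp: direct_sum_def)+

section \<open>Spaces of linear maps\<close>

lemma hom_space_carrier_iff:
  "f \<in> carrier (hom_space K V W) \<longleftrightarrow>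
    f \<in> carrier V \<rightarrow> carrier W \<and> f \<in> extensional (carrier V)
    \<and> (\<forall>x\<in>carrier V. \<forall>y\<in>carrier V. f (x \<oplus>\<^bsub>V\<^esub> y) = f x \<oplus>\<^bsub>W\<^esub> f y)
    \<and> (\<forall>c\<in>carrier K. \<forall>x\<in>carrier V. f (c \<odot>\<^bsub>V\<^esub> x) = c \<odot>\<^bsub>W\<^esub> f x)"
  by (auto simp: hom_space_def LinearCombinations.module_hom_def)

lemma hom_space_simps:
  "zero (hom_space K V W) = (\<lambda>x\<in>carrier V. \<zero>\<^bsub>W\<^esub>)"
  "f \<oplus>\<^bsub>hom_space K V W\<^esub> g = (\<lambda>x\<in>carrier V. f x \<oplus>\<^bsub>W\<^esub> g x)"
  "c \<odot>\<^bsub>hom_space K V W\<^esub> f = (\<lambda>x\<in>carrier V. c \<odot>\<^bsub>W\<^esub> f x)"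
  by (simp_all add: hom_space_def)

lemma hom_space_eqI:
  assumes "f \<in> carrier (hom_space K V W)" "g \<in> carrier (hom_space K V W)"
    and "\<And>x. x \<in> carrier V \<Longrightarrow> f x = g x"
  shows "f = g"
  using assms extensionalityI unfolding hom_space_carrier_iff by blast

lemma restrict_in_hom_space:
  assumes "vectorspace K V"
    and "\<And>x. x \<in> carrier V \<Longrightarrow> f x \<in> carrier W"
    and "\<And>x y. x \<in> carrier V \<Longrightarrow> y \<in> carrier V \<Longrightarrow> f (x \<oplus>\<^bsub>V\<^esub> y) = f x \<oplus>\<^bsub>W\<^esub> f y"
    and "\<And>c x. c \<in> carrier K \<Longrightarrow> x \<in> carrier V \<Longrightarrow> f (c \<odot>\<^bsub>V\<^esub> x) = c \<odot>\<^bsub>W\<^esub> f x"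
  shows "restrict f (carrier V) \<in> carrier (hom_space K V W)"
proof -
  interpret V: vectorspace K V by fact
  show ?thesis using assms(2-) by (auto simp: hom_space_carrier_iff)
qed

lemma hom_space_vectorspace:
  assumes "vectorspace K V" and "vectorspace K W"
  shows "vectorspace K (hom_space K V W)"
proof -
  interpret V: vectorspace K V by fact
  interpret W: vectorspace K W by fact
  note iff = hom_space_carrier_iff[of _ K V W]
  have closed: "f x \<in> carrier W" if "f \<in> carrier (hom_space K V W)" "x \<in> carrier V" for f x
    using that by (auto simp: iff)
  show ?thesis
  proof (rule vs_criteria)
    show "field K" by (rule V.field_axioms)
    show "\<zero>\<^bsub>hom_space K V W\<^esub> \<in> carrier (hom_space K V W)"
      unfolding hom_space_simps by (rule restrict_in_hom_space[OF assms(1)]) auto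
    show "\<forall>f g. f \<in> carrier (hom_space K V W) \<and> g \<in> carrier (hom_space K V W) \<longrightarrow>
        f \<oplus>\<^bsub>hom_space K V W\<^esub> g \<in> carrier (hom_space K V W)"
      unfolding hom_space_simps
      by (intro allI impI restrict_in_hom_space[OF assms(1)])
         (auto simp: iff W.smult_r_distr Pi_iff W.module.M.add.m_ac)
    show "\<forall>f\<in>carrier (hom_space K V W). \<exists>g\<in>carrier (hom_space K V W).
        f \<oplus>\<^bsub>hom_space K V W\<^esub> g = \<zero>\<^bsub>hom_space K V W\<^esub>"
    proof
      fix f assume f: "f \<in> carrier (hom_space K V W)"
      let ?g = "\<lambda>x\<in>carrier V. \<ominus>\<^bsub>W\<^esub> f x"
      have "?g \<in> carrier (hom_space K V W)"
        using f by (intro restrict_in_hom_space[OF assms(1)])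
          (auto simp: iff W.smult_r_minus Pi_iff W.module.M.minus_add)
      moreover have "f \<oplus>\<^bsub>hom_space K V W\<^esub> ?g = \<zero>\<^bsub>hom_space K V W\<^esub>"
        unfolding hom_space_simps using closed[OF f]
        by (intro restrict_ext) (simp add: W.module.M.r_neg)
      ultimately show "\<exists>g\<in>carrier (hom_space K V W).
        f \<oplus>\<^bsub>hom_space K V W\<^esub> g = \<zero>\<^bsub>hom_space K V W\<^esub>" by blast
    qed
    show "\<forall>c f. c \<in> carrier K \<and> f \<in> carrier (hom_space K V W) \<longrightarrow>
        c \<odot>\<^bsub>hom_space K V W\<^esub> f \<in> carrier (hom_space K V W)"
      unfolding hom_space_simps
      by (intro allI impI restrict_in_hom_space[OF assms(1)])
         (auto simp: iff W.smult_r_distr Pi_iff W.smult_assoc1[symmetric] V.m_comm)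
    show "\<forall>f g. f \<in> carrier (hom_space K V W) \<and> g \<in> carrier (hom_space K V W) \<longrightarrow>
        f \<oplus>\<^bsub>hom_space K V W\<^esub> g = g \<oplus>\<^bsub>hom_space K V W\<^esub> f"
      unfolding hom_space_simps using closed
      by (auto intro!: restrict_ext W.module.M.add.m_comm)
    show "\<forall>f g h. f \<in> carrier (hom_space K V W) \<and> g \<in> carrier (hom_space K V W)
        \<and> h \<in> carrier (hom_space K V W) \<longrightarrow>
        f \<oplus>\<^bsub>hom_space K V W\<^esub> g \<oplus>\<^bsub>hom_space K V W\<^esub> h
        = f \<oplus>\<^bsub>hom_space K V W\<^esub> (g \<oplus>\<^bsub>hom_space K V W\<^esub> h)"
      unfolding hom_space_simps using closed
      by (auto intro!: restrict_ext W.module.M.add.m_assoc)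
    show "\<forall>f\<in>carrier (hom_space K V W). f \<oplus>\<^bsub>hom_space K V W\<^esub> \<zero>\<^bsub>hom_space K V W\<^esub> = f"
      unfolding hom_space_simps using closed
      by (auto simp: iff intro!: extensionalityI[of _ "carrier V"])
    show "\<forall>a b f. a \<in> carrier K \<and> b \<in> carrier K \<and> f \<in> carrier (hom_space K V W) \<longrightarrow>
        (a \<otimes>\<^bsub>K\<^esub> b) \<odot>\<^bsub>hom_space K V W\<^esub> f
        = a \<odot>\<^bsub>hom_space K V W\<^esub> (b \<odot>\<^bsub>hom_space K V W\<^esub> f)"
      unfolding hom_space_simps using closed
      by (auto intro!: restrict_ext W.smult_assoc1)
    show "\<forall>f\<in>carrier (hom_space K V W). \<one>\<^bsub>K\<^esub> \<odot>\<^bsub>hom_space K V W\<^esub> f = f"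
      unfolding hom_space_simps using closed
      by (auto simp: iff intro!: extensionalityI[of _ "carrier V"])
    show "\<forall>a b f. a \<in> carrier K \<and> b \<in> carrier K \<and> f \<in> carrier (hom_space K V W) \<longrightarrow>
        (a \<oplus>\<^bsub>K\<^esub> b) \<odot>\<^bsub>hom_space K V W\<^esub> f
        = a \<odot>\<^bsub>hom_space K V W\<^esub> f \<oplus>\<^bsub>hom_space K V W\<^esub> b \<odot>\<^bsub>hom_space K V W\<^esub> f"
      unfolding hom_space_simps using closed
      by (auto intro!: restrict_ext W.smult_l_distr)
    show "\<forall>a f g. a \<in> carrier K \<and> f \<in> carrier (hom_space K V W)
        \<and> g \<in> carrier (hom_space K V W) \<longrightarrow>
        a \<odot>\<^bsub>hom_space K V W\<^esub> (f \<oplus>\<^bsub>hom_space K V W\<^esub> g)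
        = a \<odot>\<^bsub>hom_space K V W\<^esub> f \<oplus>\<^bsub>hom_space K V W\<^esub> a \<odot>\<^bsub>hom_space K V W\<^esub> g"
      unfolding hom_space_simps using closed
      by (auto intro!: restrict_ext W.smult_r_distr)
  qed
qed

lemma hom_space_linear_map:
  assumes "vectorspace K V" "vectorspace K W" "f \<in> carrier (hom_space K V W)"
  shows "linear_map K V W f"
  using assms(3) by (intro linear_mapI[OF assms(1,2)]) (auto simp: hom_space_carrier_iff)

lemma hom_space_eval_linear:
  assumes "vectorspace K V" "vectorspace K W" "x \<in> carrier V"
  shows "linear_map K (hom_space K V W) W (\<lambda>f. f x)"
  using assms(3)
  by (intro linear_mapI[OF hom_space_vectorspace[OF assms(1,2)] assms(2)])
     (auto simp: hom_space_simps hom_space_carrier_iff)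

text \<open>
  With an inclusion for \<open>i\<close> and a projection for \<open>p\<close> this is the passage from an endomorphism of a
  direct sum to one of its matrix blocks.
\<close>
lemma hom_space_sandwich_linear:
  assumes i: "linear_map K U V i" and p: "linear_map K W X p"
  shows "linear_map K (hom_space K V W) (hom_space K U X) (\<lambda>f. \<lambda>u\<in>carrier U. p (f (i u)))"
proof -
  interpret i: linear_map K U V i by fact
  interpret p: linear_map K W X p by fact
  have val: "f v \<in> carrier W" if "f \<in> carrier (hom_space K V W)" "v \<in> carrier V" for f v
    using that by (auto simp: hom_space_carrier_iff)
  show ?thesis
  proof (rule linear_mapI[OF
        hom_space_vectorspace[OF i.W.vectorspace_axioms p.V.vectorspace_axioms]
        hom_space_vectorspace[OF i.V.vectorspace_axioms p.W.vectorspace_axioms]])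
    fix f assume "f \<in> carrier (hom_space K V W)"
    then show "(\<lambda>u\<in>carrier U. p (f (i u))) \<in> carrier (hom_space K U X)"
      by (intro restrict_in_hom_space[OF i.V.vectorspace_axioms])
        (auto simp: hom_space_carrier_iff Pi_iff)
  qed (auto simp: hom_space_simps val intro!: restrict_ext)
qed

text \<open>
  The difference in a space of maps is defined through the additive inverse of its record, which has
  no explicit formula; linearity of evaluation computes it pointwise.
\<close>
lemma hom_space_minus_apply:
  assumes "vectorspace K V" "vectorspace K W" and x: "x \<in> carrier V"
    and "f \<in> carrier (hom_space K V W)" "g \<in> carrier (hom_space K V W)"
  shows "(f \<ominus>\<^bsub>hom_space K V W\<^esub> g) x = f x \<ominus>\<^bsub>W\<^esub> g x"
proof -
  interpret ev: linear_map K "hom_space K V W" W "\<lambda>f. f x"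
    by (rule hom_space_eval_linear[OF assms(1,2) x])
  show ?thesis using ev.T_minus assms(4,5) .
qed

section \<open>Quotient spaces\<close>

text \<open>
  Every axiom of a vector space that \<open>V\<close> satisfies passes to \<open>X\<close> along a surjection compatible
  with the operations.  Applied to the coset projection, this makes the quotient a vector space as
  soon as its operations are known on representatives.
\<close>
lemma vectorspace_surjective_image:
  fixes X :: "('a, 'w, 'n) module_scheme"
  assumes "vectorspace K V" and surj: "carrier X = T ` carrier V"
    and zero: "T \<zero>\<^bsub>V\<^esub> = \<zero>\<^bsub>X\<^esub>"
    and add: "\<And>x y. x \<in> carrier V \<Longrightarrow> y \<in> carrier V \<Longrightarrow> T x \<oplus>\<^bsub>X\<^esub> T y = T (x \<oplus>\<^bsub>V\<^esub> y)"
    and smult: "\<And>c x. c \<in> carrier K \<Longrightarrow> x \<in> carrier V \<Longrightarrow> c \<odot>\<^bsub>X\<^esub> T x = T (c \<odot>\<^bsub>V\<^esub> x)"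
  shows "vectorspace K X"
proof -
  interpret V: vectorspace K V by fact
  show ?thesis
  proof (rule vs_criteria)
    show "field K" by (rule V.field_axioms)
    show "\<forall>v\<in>carrier X. \<exists>w\<in>carrier X. v \<oplus>\<^bsub>X\<^esub> w = \<zero>\<^bsub>X\<^esub>"
    proof
      fix v assume "v \<in> carrier X"
      then obtain x where "x \<in> carrier V" "v = T x" using surj by auto
      then show "\<exists>w\<in>carrier X. v \<oplus>\<^bsub>X\<^esub> w = \<zero>\<^bsub>X\<^esub>"
        by (intro bexI[of _ "T (\<ominus>\<^bsub>V\<^esub> x)"]) (auto simp: add surj V.module.M.r_neg zero)
    qed
  qed (auto simp: surj zero[symmetric] add smult V.smult_l_distr V.smult_r_distr
      V.smult_assoc1 V.module.M.a_assoc V.module.M.a_comm V.module.M.a_lcomm)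
qed

locale vs_quotient = vectorspace K V
  for K :: "('a, 'k) ring_scheme" and V :: "('a, 'v, 'm) module_scheme" +
  fixes W :: "'v set"
  assumes subsp: "VectorSpace.subspace K W V"
begin

abbreviation proj :: "'v \<Rightarrow> 'v set" where
  "proj x \<equiv> W +>\<^bsub>V\<^esub> x"

lemma sub: "LinearCombinations.submodule K W V"
  using subsp by (simp add: VectorSpace.subspace_def)

lemma W_carrier: "x \<in> W \<Longrightarrow> x \<in> carrier V"
  using LinearCombinations.submodule.subset[OF sub] by blast

lemma W_abelian_subgroup: "abelian_subgroup W V"
proof (rule abelian_subgroupI3)
  show "abelian_group V" by (rule module.M.abelian_group_axioms)
  show "additive_subgroup W V"
  proof (rule additive_subgroupI, rule module.M.add.subgroupI)
    show "W \<subseteq> carrier V" using W_carrier by auto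
    show "W \<noteq> {}" using LinearCombinations.submodule.zero_closed[OF sub] by blast
    fix a assume a: "a \<in> W"
    have "\<ominus>\<^bsub>V\<^esub> a = (\<ominus>\<^bsub>K\<^esub> \<one>\<^bsub>K\<^esub>) \<odot>\<^bsub>V\<^esub> a"
      using a W_carrier smult_l_minus[of "\<one>\<^bsub>K\<^esub>" a] by auto
    then show "\<ominus>\<^bsub>V\<^esub> a \<in> W"
      using LinearCombinations.submodule.smult_closed[OF sub, of "\<ominus>\<^bsub>K\<^esub> \<one>\<^bsub>K\<^esub>" a] a
      by simp
  next
    fix a b assume "a \<in> W" "b \<in> W"
    then show "a \<oplus>\<^bsub>V\<^esub> b \<in> W"
      using LinearCombinations.submodule.m_closed[OF sub] by auto
  qed
qed

sublocale AS: abelian_subgroup W V by (rule W_abelian_subgroup)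

lemma quot_carrier: "carrier (quot_space V W) = proj ` carrier V"
  by (auto simp: quot_space_def A_RCOSETS_def')

lemma proj_eq_iff:
  assumes "x \<in> carrier V" "y \<in> carrier V"
  shows "proj x = proj y \<longleftrightarrow> x \<ominus>\<^bsub>V\<^esub> y \<in> W"
proof
  assume "proj x = proj y"
  then have "x \<in> proj y" using AS.a_rcos_self[OF assms(1)] by simp
  then show "x \<ominus>\<^bsub>V\<^esub> y \<in> W"
    using AS.a_rcos_module_imp[OF assms(2)] by (simp add: a_minus_def)
next
  assume "x \<ominus>\<^bsub>V\<^esub> y \<in> W"
  then have "x \<in> proj y"
    using AS.a_rcos_module_rev[OF assms(2,1)] by (simp add: a_minus_def)
  then show "proj x = proj y"
    using AS.a_repr_independence'[of x y] assms by simp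
qed

lemma proj_zero: "proj \<zero>\<^bsub>V\<^esub> = \<zero>\<^bsub>quot_space V W\<^esub>"
  using W_carrier by (simp add: quot_space_def subsetI)

lemma proj_add:
  assumes "x \<in> carrier V" "y \<in> carrier V"
  shows "proj x \<oplus>\<^bsub>quot_space V W\<^esub> proj y = proj (x \<oplus>\<^bsub>V\<^esub> y)"
  using AS.a_rcos_sum[OF assms] by (simp add: quot_space_def)

text \<open>
  Scalar multiplication of a coset is defined as a union over its elements; all members of the union
  are the same coset because \<open>W\<close> is closed under scalars.
\<close>
lemma proj_smult:
  assumes "c \<in> carrier K" "x \<in> carrier V"
  shows "c \<odot>\<^bsub>quot_space V W\<^esub> proj x = proj (c \<odot>\<^bsub>V\<^esub> x)"
proof -
  have "proj (c \<odot>\<^bsub>V\<^esub> y) = proj (c \<odot>\<^bsub>V\<^esub> x)" if "y \<in> proj x" for y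
  proof -
    have y: "y \<in> carrier V" using AS.a_elemrcos_carrier[OF assms(2) that] .
    have "y \<ominus>\<^bsub>V\<^esub> x \<in> W"
      using AS.a_rcos_module_imp[OF assms(2) that] by (simp add: a_minus_def)
    then have "c \<odot>\<^bsub>V\<^esub> (y \<ominus>\<^bsub>V\<^esub> x) \<in> W"
      using LinearCombinations.submodule.smult_closed[OF sub assms(1)] by blast
    then have "c \<odot>\<^bsub>V\<^esub> y \<ominus>\<^bsub>V\<^esub> c \<odot>\<^bsub>V\<^esub> x \<in> W"
      using assms y by (simp add: a_minus_def smult_r_distr smult_r_minus)
    then show ?thesis using proj_eq_iff assms y by simp
  qed
  moreover have "x \<in> proj x" using AS.a_rcos_self[OF assms(2)] .
  ultimately have "(\<Union>y\<in>proj x. proj (c \<odot>\<^bsub>V\<^esub> y)) = proj (c \<odot>\<^bsub>V\<^esub> x)" by blast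
  then show ?thesis by (simp add: quot_space_def)
qed

lemma quot_vectorspace: "vectorspace K (quot_space V W)"
  by (rule vectorspace_surjective_image[OF vectorspace_axioms quot_carrier proj_zero proj_add
        proj_smult])

lemma proj_linear: "linear_map K V (quot_space V W) proj"
  by (rule linear_mapI[OF vectorspace_axioms quot_vectorspace])
     (auto simp: quot_carrier proj_add proj_smult)

lemma proj_eq_zero_iff: "x \<in> carrier V \<Longrightarrow> proj x = \<zero>\<^bsub>quot_space V W\<^esub> \<longleftrightarrow> x \<in> W"
  using AS.a_rcos_self[of x] AS.a_rcos_const[of x] by (auto simp: quot_space_def)

text \<open>
  The map induced on the quotient: a linear map that vanishes on \<open>W\<close> is constant on each coset, so
  its image of a coset is a singleton.
\<close>
definition descend :: "('v \<Rightarrow> 'x) \<Rightarrow> 'v set \<Rightarrow> 'x" where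
  "descend f = (\<lambda>A\<in>carrier (quot_space V W). the_elem (f ` A))"

lemma descend_proj:
  assumes f: "linear_map K V X f" and W: "\<And>x. x \<in> W \<Longrightarrow> f x = \<zero>\<^bsub>X\<^esub>" and x: "x \<in> carrier V"
  shows "descend f (proj x) = f x"
proof -
  interpret f: linear_map K V X f by fact
  have "f y = f x" if "y \<in> proj x" for y
  proof -
    from that obtain w where w: "w \<in> W" "y = w \<oplus>\<^bsub>V\<^esub> x" by (auto simp: a_r_coset_def')
    then show ?thesis using W x W_carrier by simp
  qed
  then have "f ` proj x = {f x}" using AS.a_rcos_self[OF x] by blast
  then show ?thesis using x by (auto simp: descend_def quot_carrier)
qed

lemma descend_hom:
  assumes f: "linear_map K V X f" and W: "\<And>x. x \<in> W \<Longrightarrow> f x = \<zero>\<^bsub>X\<^esub>"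
  shows "descend f \<in> carrier (hom_space K (quot_space V W) X)"
proof -
  interpret f: linear_map K V X f by fact
  have "descend f \<in> extensional (carrier (quot_space V W))" by (simp add: descend_def)
  then show ?thesis
    by (auto simp: hom_space_carrier_iff quot_carrier descend_proj[OF assms] proj_add proj_smult)
qed

text \<open>
  The first isomorphism theorem: the induced map is injective because \<open>T x = T y\<close> puts \<open>x - y\<close> into
  the kernel \<open>W\<close>.
\<close>
theorem quot_isomorphic:
  assumes T: "linear_map K V X T" and ker: "\<And>x. x \<in> carrier V \<Longrightarrow> T x = \<zero>\<^bsub>X\<^esub> \<longleftrightarrow> x \<in> W"
    and surj: "\<And>y. y \<in> carrier X \<Longrightarrow> \<exists>x\<in>carrier V. T x = y"
  shows "vs_isomorphic K (quot_space V W) X"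
proof -
  interpret T: linear_map K V X T by fact
  have W: "T x = \<zero>\<^bsub>X\<^esub>" if "x \<in> W" for x using that ker W_carrier by blast
  note [simp] = descend_proj[OF T W]
  have lin: "linear_map K (quot_space V W) X (descend T)"
    by (rule linear_mapI[OF quot_vectorspace T.W.vectorspace_axioms])
       (auto simp: quot_carrier proj_add proj_smult)
  have "inj_on (descend T) (carrier (quot_space V W))"
  proof (rule inj_onI)
    fix A B assume A: "A \<in> carrier (quot_space V W)" and B: "B \<in> carrier (quot_space V W)"
      and eq: "descend T A = descend T B"
    from A B obtain x y where xy: "x \<in> carrier V" "A = proj x" "y \<in> carrier V" "B = proj y"
      by (auto simp: quot_carrier)
    then have "T x = T y" using eq by simp
    then have "T (x \<ominus>\<^bsub>V\<^esub> y) = \<zero>\<^bsub>X\<^esub>" using xy by simp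
    then have "x \<ominus>\<^bsub>V\<^esub> y \<in> W" using ker xy by (metis module.M.minus_closed)
    then show "A = B" using xy proj_eq_iff by simp
  qed
  moreover have "descend T ` carrier (quot_space V W) = carrier X"
    using surj by (force simp: quot_carrier image_image)
  ultimately show ?thesis using lin unfolding vs_isomorphic_def bij_betw_def by blast
qed

text \<open>
  Inducing maps on the quotient is itself a linear operation, since the induced map is determined by
  its values on the cosets of single vectors.
\<close>
lemma descend_linear:
  assumes B: "linear_map K U (hom_space K V X) B" and X: "vectorspace K X"
    and W: "\<And>u w. u \<in> carrier U \<Longrightarrow> w \<in> W \<Longrightarrow> B u w = \<zero>\<^bsub>X\<^esub>"
  shows "linear_map K U (hom_space K (quot_space V W) X) (\<lambda>u. descend (B u))"
proof -
  interpret B: linear_map K U "hom_space K V X" B by fact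
  interpret Q: vectorspace K "hom_space K (quot_space V W) X"
    by (rule hom_space_vectorspace[OF quot_vectorspace X])
  have lin: "linear_map K V X (B u)" if "u \<in> carrier U" for u
    using hom_space_linear_map[OF vectorspace_axioms X] that by blast
  have hom: "descend (B u) \<in> carrier (hom_space K (quot_space V W) X)" if "u \<in> carrier U" for u
    using descend_hom[OF lin W] that by blast
  have val: "descend (B u) (proj x) = B u x" if "u \<in> carrier U" "x \<in> carrier V" for u x
    using descend_proj[OF lin W] that by blast
  show ?thesis
  proof (rule linear_mapI[OF B.V.vectorspace_axioms Q.vectorspace_axioms])
    fix u v assume uv: "u \<in> carrier U" "v \<in> carrier U"
    then show "descend (B (u \<oplus>\<^bsub>U\<^esub> v))
        = descend (B u) \<oplus>\<^bsub>hom_space K (quot_space V W) X\<^esub> descend (B v)"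
      by (intro hom_space_eqI[OF hom Q.module.M.a_closed[OF hom hom]])
         (auto simp: quot_carrier hom_space_simps(2) val simp del: B.f_add, simp add: hom_space_simps)
  next
    fix c u assume "c \<in> carrier K" "u \<in> carrier U"
    then show "descend (B (c \<odot>\<^bsub>U\<^esub> u)) = c \<odot>\<^bsub>hom_space K (quot_space V W) X\<^esub> descend (B u)"
      by (intro hom_space_eqI[OF hom Q.smult_closed[OF _ hom]])
         (auto simp: quot_carrier hom_space_simps(3) val simp del: B.f_smult, simp add: hom_space_simps)
  qed (rule hom)
qed

end

section \<open>Derivations, centroid and center\<close>

context lie_algebra
begin

abbreviation Der :: "('v \<Rightarrow> 'v) set" where
  "Der \<equiv> derivations K V br"

abbreviation Inn :: "('v \<Rightarrow> 'v) set" where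
  "Inn \<equiv> inner_derivations V br"

abbreviation Der_space :: "('a, 'v \<Rightarrow> 'v) module" where
  "Der_space \<equiv> (hom_space K V V)\<lparr>carrier := Der\<rparr>"

lemma br_left_linear: "x \<in> carrier V \<Longrightarrow> linear_map K V V (\<lambda>y. br y x)"
  by (rule linear_mapI[OF vectorspace_axioms vectorspace_axioms])
     (simp_all add: br_closed br_add_left br_smult_left)

lemma br_right_linear: "x \<in> carrier V \<Longrightarrow> linear_map K V V (br x)"
  by (rule linear_mapI[OF vectorspace_axioms vectorspace_axioms])
     (simp_all add: br_closed br_add_right br_smult_right)

lemma br_zero:
  assumes "x \<in> carrier V"
  shows "br \<zero>\<^bsub>V\<^esub> x = \<zero>\<^bsub>V\<^esub>" and "br x \<zero>\<^bsub>V\<^esub> = \<zero>\<^bsub>V\<^esub>"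
proof -
  interpret L: linear_map K V V "\<lambda>y. br y x" by (rule br_left_linear[OF assms])
  interpret R: linear_map K V V "br x" by (rule br_right_linear[OF assms])
  show "br \<zero>\<^bsub>V\<^esub> x = \<zero>\<^bsub>V\<^esub>" "br x \<zero>\<^bsub>V\<^esub> = \<zero>\<^bsub>V\<^esub>" by (rule L.T0_is_0 R.T0_is_0)+
qed

lemma br_neg:
  assumes "x \<in> carrier V" "y \<in> carrier V"
  shows "br (\<ominus>\<^bsub>V\<^esub> y) x = \<ominus>\<^bsub>V\<^esub> br y x" and "br x (\<ominus>\<^bsub>V\<^esub> y) = \<ominus>\<^bsub>V\<^esub> br x y"
proof -
  interpret L: linear_map K V V "\<lambda>y. br y x" by (rule br_left_linear[OF assms(1)])
  interpret R: linear_map K V V "br x" by (rule br_right_linear[OF assms(1)])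
  show "br (\<ominus>\<^bsub>V\<^esub> y) x = \<ominus>\<^bsub>V\<^esub> br y x" "br x (\<ominus>\<^bsub>V\<^esub> y) = \<ominus>\<^bsub>V\<^esub> br x y"
    using assms by (simp_all only: L.T_neg R.T_neg)
qed

text \<open>
  Polarization: expand \<open>[x + y, x + y] = 0\<close>.
\<close>
lemma br_antisym:
  assumes x: "x \<in> carrier V" and y: "y \<in> carrier V"
  shows "br x y = \<ominus>\<^bsub>V\<^esub> br y x"
proof (rule module.M.add_eq_zeroD)
  have "\<zero>\<^bsub>V\<^esub> = br (x \<oplus>\<^bsub>V\<^esub> y) (x \<oplus>\<^bsub>V\<^esub> y)" using x y by (simp add: br_self)
  also have "\<dots> = br x y \<oplus>\<^bsub>V\<^esub> br y x"
    using x y by (simp add: br_add_left br_add_right br_closed br_self[OF x] br_self[OF y]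
        module.M.a_comm)
  finally show "br x y \<oplus>\<^bsub>V\<^esub> br y x = \<zero>\<^bsub>V\<^esub>" by simp
qed (use x y br_closed in auto)

text \<open>
  The Jacobi identity in the form used below: bracketing with \<open>x\<close> is a derivation.
\<close>
lemma br_derivation:
  assumes x: "x \<in> carrier V" and y: "y \<in> carrier V" and z: "z \<in> carrier V"
  shows "br x (br y z) = br (br x y) z \<oplus>\<^bsub>V\<^esub> br y (br x z)"
proof -
  have "br x (br y z) \<oplus>\<^bsub>V\<^esub> (br y (br z x) \<oplus>\<^bsub>V\<^esub> br z (br x y)) = \<zero>\<^bsub>V\<^esub>"
    using jacobi[OF assms] assms by (simp add: br_closed module.M.a_assoc)
  then have "br x (br y z) = \<ominus>\<^bsub>V\<^esub> (br y (br z x) \<oplus>\<^bsub>V\<^esub> br z (br x y))"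
    using assms by (intro module.M.add_eq_zeroD) (auto simp: br_closed)
  also have "\<dots> = \<ominus>\<^bsub>V\<^esub> br z (br x y) \<oplus>\<^bsub>V\<^esub> \<ominus>\<^bsub>V\<^esub> br y (br z x)"
    using assms by (simp add: br_closed module.M.minus_add module.M.a_comm)
  also have "\<ominus>\<^bsub>V\<^esub> br z (br x y) = br (br x y) z"
    using br_antisym[of "br x y" z] assms by (simp add: br_closed)
  also have "\<ominus>\<^bsub>V\<^esub> br y (br z x) = br y (br x z)"
    using br_antisym[of x z] br_neg(2)[of y "br z x"] assms by (simp add: br_closed)
  finally show ?thesis .
qed

lemma derivationI:
  assumes "D \<in> carrier (hom_space K V V)"
    and "\<And>x y. x \<in> carrier V \<Longrightarrow> y \<in> carrier V \<Longrightarrow> D (br x y) = br (D x) y \<oplus>\<^bsub>V\<^esub> br x (D y)"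
  shows "D \<in> Der"
  using assms by (simp add: derivations_def)

lemma derivationD:
  assumes "D \<in> Der"
  shows "D \<in> carrier (hom_space K V V)"
    and "x \<in> carrier V \<Longrightarrow> D x \<in> carrier V"
    and "x \<in> carrier V \<Longrightarrow> y \<in> carrier V \<Longrightarrow> D (x \<oplus>\<^bsub>V\<^esub> y) = D x \<oplus>\<^bsub>V\<^esub> D y"
    and "c \<in> carrier K \<Longrightarrow> x \<in> carrier V \<Longrightarrow> D (c \<odot>\<^bsub>V\<^esub> x) = c \<odot>\<^bsub>V\<^esub> D x"
    and "x \<in> carrier V \<Longrightarrow> y \<in> carrier V \<Longrightarrow> D (br x y) = br (D x) y \<oplus>\<^bsub>V\<^esub> br x (D y)"
  using assms by (auto simp: derivations_def hom_space_carrier_iff)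

lemma hom_vectorspace: "vectorspace K (hom_space K V V)"
  by (rule hom_space_vectorspace[OF vectorspace_axioms vectorspace_axioms])

lemma derivations_subspace: "VectorSpace.subspace K Der (hom_space K V V)"
proof -
  interpret H: vectorspace K "hom_space K V V" by (rule hom_vectorspace)
  show ?thesis
  proof (rule H.subspaceI)
    show "Der \<subseteq> carrier (hom_space K V V)" by (auto simp: derivations_def)
    show "\<zero>\<^bsub>hom_space K V V\<^esub> \<in> Der"
      by (rule derivationI[OF H.module.M.zero_closed])
        (simp_all add: hom_space_simps br_closed br_zero)
  next
    fix D E assume D: "D \<in> Der" and E: "E \<in> Der"
    then show "D \<oplus>\<^bsub>hom_space K V V\<^esub> E \<in> Der"
      by (intro derivationI[OF H.module.M.a_closed[OF derivationD(1)[OF D] derivationD(1)[OF E]]])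
        (simp_all add: hom_space_simps br_closed derivationD(2,5)[OF D]
          derivationD(2,5)[OF E] br_add_left br_add_right module.M.a_ac)
  next
    fix c D assume c: "c \<in> carrier K" and D: "D \<in> Der"
    then show "c \<odot>\<^bsub>hom_space K V V\<^esub> D \<in> Der"
      by (intro derivationI[OF H.smult_closed[OF c derivationD(1)[OF D]]])
        (simp_all add: hom_space_simps br_closed derivationD(2,5)[OF D] br_smult_left br_smult_right
          smult_r_distr)
  qed
qed

lemma Der_vectorspace: "vectorspace K Der_space"
  by (rule vectorspace.subspace_is_vs[OF hom_vectorspace derivations_subspace])

lemma inner_derivations_subspace: "VectorSpace.subspace K Inn Der_space"
proof -
  interpret D: vectorspace K Der_space by (rule Der_vectorspace)
  have ad: "(\<lambda>y\<in>carrier V. br x y) \<in> Der" if x: "x \<in> carrier V" for x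
    using x
    by (intro derivationI restrict_in_hom_space[OF vectorspace_axioms])
       (simp_all add: br_closed br_add_right br_smult_right br_derivation[of x])
  show ?thesis
  proof (rule D.subspaceI)
    show "Inn \<subseteq> carrier Der_space" using ad by (auto simp: inner_derivations_def)
    have "\<zero>\<^bsub>Der_space\<^esub> = (\<lambda>y\<in>carrier V. br \<zero>\<^bsub>V\<^esub> y)"
      by (auto simp: hom_space_simps br_zero intro!: restrict_ext)
    then show "\<zero>\<^bsub>Der_space\<^esub> \<in> Inn" by (auto simp: inner_derivations_def)
  next
    fix D E assume "D \<in> Inn" "E \<in> Inn"
    then obtain x y where "x \<in> carrier V" "D = (\<lambda>z\<in>carrier V. br x z)"
      and "y \<in> carrier V" "E = (\<lambda>z\<in>carrier V. br y z)"
      by (auto simp: inner_derivations_def)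
    then have "x \<oplus>\<^bsub>V\<^esub> y \<in> carrier V \<and> D \<oplus>\<^bsub>Der_space\<^esub> E = (\<lambda>z\<in>carrier V. br (x \<oplus>\<^bsub>V\<^esub> y) z)"
      by (auto simp: hom_space_simps br_add_left intro!: restrict_ext)
    then show "D \<oplus>\<^bsub>Der_space\<^esub> E \<in> Inn" unfolding inner_derivations_def by blast
  next
    fix c D assume "c \<in> carrier K" "D \<in> Inn"
    then obtain x where "x \<in> carrier V" "D = (\<lambda>z\<in>carrier V. br x z)"
      by (auto simp: inner_derivations_def)
    then have "c \<odot>\<^bsub>V\<^esub> x \<in> carrier V \<and> c \<odot>\<^bsub>Der_space\<^esub> D = (\<lambda>z\<in>carrier V. br (c \<odot>\<^bsub>V\<^esub> x) z)"
      using \<open>c \<in> carrier K\<close> by (auto simp: hom_space_simps br_smult_left intro!: restrict_ext)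
    then show "c \<odot>\<^bsub>Der_space\<^esub> D \<in> Inn" unfolding inner_derivations_def by blast
  qed
qed

lemma H1_quotient: "vs_quotient K Der_space Inn"
  using Der_vectorspace inner_derivations_subspace
  by (simp add: vs_quotient_def vs_quotient_axioms_def)

lemma centroidI:
  assumes "f \<in> carrier (hom_space K V V)"
    and "\<And>x y. x \<in> carrier V \<Longrightarrow> y \<in> carrier V \<Longrightarrow> f (br x y) = br x (f y)"
  shows "f \<in> carrier (centroid K V br)"
  using assms by (simp add: centroid_def)

lemma centroidD:
  assumes "f \<in> carrier (centroid K V br)"
  shows "f \<in> carrier (hom_space K V V)"
    and "x \<in> carrier V \<Longrightarrow> f x \<in> carrier V"
    and "x \<in> carrier V \<Longrightarrow> y \<in> carrier V \<Longrightarrow> f (x \<oplus>\<^bsub>V\<^esub> y) = f x \<oplus>\<^bsub>V\<^esub> f y"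
    and "c \<in> carrier K \<Longrightarrow> x \<in> carrier V \<Longrightarrow> f (c \<odot>\<^bsub>V\<^esub> x) = c \<odot>\<^bsub>V\<^esub> f x"
    and "x \<in> carrier V \<Longrightarrow> y \<in> carrier V \<Longrightarrow> f (br x y) = br x (f y)"
  using assms by (auto simp: centroid_def hom_space_carrier_iff)

lemma centroid_subspace:
  "VectorSpace.subspace K (carrier (centroid K V br)) (hom_space K V V)"
proof -
  interpret H: vectorspace K "hom_space K V V" by (rule hom_vectorspace)
  show ?thesis
  proof (rule H.subspaceI)
    show "carrier (centroid K V br) \<subseteq> carrier (hom_space K V V)" by (auto simp: centroidD(1))
    show "\<zero>\<^bsub>hom_space K V V\<^esub> \<in> carrier (centroid K V br)"
      by (rule centroidI[OF H.module.M.zero_closed])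
        (simp_all add: hom_space_simps br_closed br_zero)
  next
    fix f g assume f: "f \<in> carrier (centroid K V br)" and g: "g \<in> carrier (centroid K V br)"
    show "f \<oplus>\<^bsub>hom_space K V V\<^esub> g \<in> carrier (centroid K V br)"
      by (rule centroidI[OF H.module.M.a_closed[OF centroidD(1)[OF f] centroidD(1)[OF g]]])
        (simp add: hom_space_simps br_closed br_add_right centroidD(2,5)[OF f] centroidD(2,5)[OF g])
  next
    fix c f assume c: "c \<in> carrier K" and f: "f \<in> carrier (centroid K V br)"
    show "c \<odot>\<^bsub>hom_space K V V\<^esub> f \<in> carrier (centroid K V br)"
      by (rule centroidI[OF H.smult_closed[OF c centroidD(1)[OF f]]])
        (simp add: hom_space_simps br_closed br_smult_right c centroidD(2,5)[OF f])
  qed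
qed

lemma center_subspace: "VectorSpace.subspace K (lie_center V br) V"
  by (rule subspaceI)
     (auto simp: lie_center_def br_zero br_add_left br_smult_left)

lemma center_br:
  assumes "z \<in> lie_center V br" "x \<in> carrier V"
  shows "z \<in> carrier V" "br z x = \<zero>\<^bsub>V\<^esub>" "br x z = \<zero>\<^bsub>V\<^esub>"
  using assms br_antisym[of x z] module.M.a_inv_zero by (auto simp: lie_center_def)

lemma derived_subspace: "VectorSpace.subspace K (derived_subspace K V br) V"
  unfolding derived_subspace_def by (rule span_is_subspace) (auto simp: br_closed)

lemma abelianization_quotient: "vs_quotient K V (derived_subspace K V br)"
  using vectorspace_axioms derived_subspace by (simp add: vs_quotient_def vs_quotient_axioms_def)

text \<open>
  The kernel of \<open>f\<close> is a subspace that contains all brackets, hence contains their span.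
\<close>
lemma vanishes_on_derived_subspace:
  assumes f: "linear_map K V X f"
    and "\<And>x y. x \<in> carrier V \<Longrightarrow> y \<in> carrier V \<Longrightarrow> f (br x y) = \<zero>\<^bsub>X\<^esub>"
    and "x \<in> derived_subspace K V br"
  shows "f x = \<zero>\<^bsub>X\<^esub>"
proof -
  interpret f: linear_map K V X f by fact
  have "derived_subspace K V br \<subseteq> f.ker"
    unfolding derived_subspace_def
    by (rule span_is_subset[OF _ f.ker_is_submodule]) (auto simp: f.ker_def br_closed assms(2))
  then show ?thesis using assms(3) by (auto simp: f.ker_def)
qed

end

section \<open>The semi-direct product and its derivations\<close>

context lie_algebra
begin

abbreviation H where "H \<equiv> direct_sum V V"
abbreviation hbr where "hbr \<equiv> semidirect_br V br"

lemma semidirect_lie_algebra: "lie_algebra K H hbr"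
proof -
  interpret H: vectorspace K H
    by (rule direct_sum_is_vs[OF vectorspace_axioms vectorspace_axioms])
  show ?thesis
  proof
    fix X Y Z assume "X \<in> carrier H" "Y \<in> carrier H" "Z \<in> carrier H"
    then obtain a x b y c z where
      X: "X = (a, x)" "a \<in> carrier V" "x \<in> carrier V" and
      Y: "Y = (b, y)" "b \<in> carrier V" "y \<in> carrier V" and
      Z: "Z = (c, z)" "c \<in> carrier V" "z \<in> carrier V"
      by (auto simp: direct_sum_simps)
    have "br x (br y c) = br (br x y) c \<oplus>\<^bsub>V\<^esub> br y (br x c)"
      "br y (br z a) = br (br y z) a \<oplus>\<^bsub>V\<^esub> br z (br y a)"
      "br z (br x b) = br (br z x) b \<oplus>\<^bsub>V\<^esub> br x (br z b)"
      using X Y Z by (intro br_derivation; simp)+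
    \<comment> \<open>Once the three instances of the Jacobi identity are substituted, the module component is a
        sum of six terms and of their negatives.  Rearrangement alone does not bring each term next
        to its negative, so the cancellation \<open>S - S = 0\<close> is supplied for the whole sum.\<close>
    moreover have "S \<oplus>\<^bsub>V\<^esub> \<ominus>\<^bsub>V\<^esub> S = \<zero>\<^bsub>V\<^esub>"
      if "S = br x (br z b) \<oplus>\<^bsub>V\<^esub> br y (br x c) \<oplus>\<^bsub>V\<^esub> br z (br y a) \<oplus>\<^bsub>V\<^esub> br (br x y) c
        \<oplus>\<^bsub>V\<^esub> br (br y z) a \<oplus>\<^bsub>V\<^esub> br (br z x) b" for S
      using that X Y Z by (simp add: br_closed module.M.r_neg)
    ultimately show "hbr X (hbr Y Z) \<oplus>\<^bsub>H\<^esub> hbr Y (hbr Z X) \<oplus>\<^bsub>H\<^esub> hbr Z (hbr X Y) = \<zero>\<^bsub>H\<^esub>"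
      using X Y Z jacobi[of x y z]
      by (simp add: direct_sum_simps semidirect_br_def br_closed br_add_left br_add_right br_neg
          module.M.minus_eq module.M.minus_add module.M.a_ac)
  qed (auto simp: direct_sum_simps semidirect_br_def br_closed br_add_left br_add_right
      br_smult_left br_smult_right br_self module.M.minus_eq module.M.minus_add module.M.a_ac
      smult_r_distr smult_r_minus module.M.r_neg)
qed

text \<open>
  A block of \<open>D\<close> is selected by the inclusion \<open>i\<close> of a source summand and the projection \<open>p\<close> to a
  target summand.
\<close>
definition block :: "('v \<times> 'v \<Rightarrow> 'v) \<Rightarrow> ('v \<Rightarrow> 'v \<times> 'v) \<Rightarrow> ('v \<times> 'v \<Rightarrow> 'v \<times> 'v) \<Rightarrow> 'v \<Rightarrow> 'v" where
  "block p i D = (\<lambda>x\<in>carrier V. p (D (i x)))"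

abbreviation incl1 :: "'v \<Rightarrow> 'v \<times> 'v" where "incl1 \<equiv> \<lambda>m. (m, \<zero>\<^bsub>V\<^esub>)"
abbreviation incl2 :: "'v \<Rightarrow> 'v \<times> 'v" where "incl2 \<equiv> \<lambda>g. (\<zero>\<^bsub>V\<^esub>, g)"

definition from_blocks ::
  "('v \<Rightarrow> 'v) \<Rightarrow> ('v \<Rightarrow> 'v) \<Rightarrow> ('v \<Rightarrow> 'v) \<Rightarrow> ('v \<Rightarrow> 'v) \<Rightarrow> 'v \<times> 'v \<Rightarrow> 'v \<times> 'v"
  where "from_blocks A B C E =
    (\<lambda>p\<in>carrier H. (A (fst p) \<oplus>\<^bsub>V\<^esub> B (snd p), C (fst p) \<oplus>\<^bsub>V\<^esub> E (snd p)))"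

lemma block_linear:
  assumes "linear_map K H V p" "linear_map K V H i"
  shows "linear_map K (hom_space K H H) (hom_space K V V) (block p i)"
  using hom_space_sandwich_linear[OF assms(2,1)] unfolding block_def[abs_def] .

lemmas block_linears =
  block_linear[OF fst_snd_linear(1) inclusions_linear(1)]
  block_linear[OF fst_snd_linear(1) inclusions_linear(2)]
  block_linear[OF fst_snd_linear(2) inclusions_linear(1)]
  block_linear[OF fst_snd_linear(2) inclusions_linear(2)]

lemma block_hom:
  assumes "D \<in> carrier (hom_space K H H)"
  shows "block fst incl1 D \<in> carrier (hom_space K V V)"
    and "block fst incl2 D \<in> carrier (hom_space K V V)"
    and "block snd incl1 D \<in> carrier (hom_space K V V)"
    and "block snd incl2 D \<in> carrier (hom_space K V V)"
  using block_linears[THEN linear_map.axioms(3)] assms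
  by (auto simp: mod_hom_def mod_hom_axioms_def LinearCombinations.module_hom_def)

lemma hom_eq_from_blocks:
  assumes D: "D \<in> carrier (hom_space K H H)"
  shows "D = from_blocks (block fst incl1 D) (block fst incl2 D)
    (block snd incl1 D) (block snd incl2 D)"
proof (rule extensionalityI)
  show "D \<in> extensional (carrier H)" using D by (simp add: hom_space_carrier_iff)
  fix p assume p: "p \<in> carrier H"
  then have "p = incl1 (fst p) \<oplus>\<^bsub>H\<^esub> incl2 (snd p)"
    and "incl1 (fst p) \<in> carrier H" "incl2 (snd p) \<in> carrier H"
    by (auto simp: direct_sum_simps)
  then have "D p = D (incl1 (fst p)) \<oplus>\<^bsub>H\<^esub> D (incl2 (snd p))"
    using D unfolding hom_space_carrier_iff by metis
  then show "D p = from_blocks (block fst incl1 D) (block fst incl2 D)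
      (block snd incl1 D) (block snd incl2 D) p"
    using p by (auto simp: from_blocks_def block_def direct_sum_simps)
qed (simp add: from_blocks_def)

lemma from_blocks_hom:
  assumes "A \<in> carrier (hom_space K V V)" "B \<in> carrier (hom_space K V V)"
    "C \<in> carrier (hom_space K V V)" "E \<in> carrier (hom_space K V V)"
  shows "from_blocks A B C E \<in> carrier (hom_space K H H)"
  using assms unfolding from_blocks_def
  by (intro restrict_in_hom_space direct_sum_is_vs vectorspace_axioms)
     (auto simp: direct_sum_simps hom_space_carrier_iff Pi_iff module.M.a_ac smult_r_distr)

lemma block_from_blocks:
  assumes "A \<in> carrier (hom_space K V V)" "B \<in> carrier (hom_space K V V)"
    "C \<in> carrier (hom_space K V V)" "E \<in> carrier (hom_space K V V)"
  shows "block fst incl1 (from_blocks A B C E) = A" "block fst incl2 (from_blocks A B C E) = B"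
    "block snd incl1 (from_blocks A B C E) = C" "block snd incl2 (from_blocks A B C E) = E"
proof -
  have zero: "f \<zero>\<^bsub>V\<^esub> = \<zero>\<^bsub>V\<^esub>" if "f \<in> carrier (hom_space K V V)" for f
  proof -
    interpret f: linear_map K V V f
      by (rule hom_space_linear_map[OF vectorspace_axioms vectorspace_axioms that])
    show ?thesis by (rule f.T0_is_0)
  qed
  have val: "f x \<in> carrier V" if "f \<in> carrier (hom_space K V V)" "x \<in> carrier V" for f x
    using that by (auto simp: hom_space_carrier_iff)
  have ext: "f \<in> extensional (carrier V)" if "f \<in> carrier (hom_space K V V)" for f
    using that by (auto simp: hom_space_carrier_iff)
  show "block fst incl1 (from_blocks A B C E) = A" "block fst incl2 (from_blocks A B C E) = B"
    "block snd incl1 (from_blocks A B C E) = C" "block snd incl2 (from_blocks A B C E) = E"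
    by (auto simp: block_def from_blocks_def direct_sum_simps assms[THEN zero] assms[THEN val]
          assms[THEN ext] intro!: extensionalityI[of _ "carrier V"])
qed

text \<open>
  These maps are the elements of \<open>Hom (\<gg>/[\<gg>, \<gg>], Z \<gg>)\<close> before they are descended to the
  quotient.
\<close>
definition central_homs :: "('v \<Rightarrow> 'v) set" where
  "central_homs = {C \<in> carrier (hom_space K V V).
    (\<forall>x\<in>carrier V. C x \<in> lie_center V br)
    \<and> (\<forall>x\<in>carrier V. \<forall>y\<in>carrier V. C (br x y) = \<zero>\<^bsub>V\<^esub>)}"

lemma central_homsD:
  assumes C: "C \<in> central_homs"
  shows "C \<in> carrier (hom_space K V (V\<lparr>carrier := lie_center V br\<rparr>))"
    and "linear_map K V (V\<lparr>carrier := lie_center V br\<rparr>) C"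
    and "x \<in> derived_subspace K V br \<Longrightarrow> C x = \<zero>\<^bsub>V\<^esub>"
proof -
  show hom: "C \<in> carrier (hom_space K V (V\<lparr>carrier := lie_center V br\<rparr>))"
    using C by (auto simp: central_homs_def hom_space_carrier_iff)
  show lin: "linear_map K V (V\<lparr>carrier := lie_center V br\<rparr>) C"
    by (rule hom_space_linear_map[OF vectorspace_axioms subspace_is_vs[OF center_subspace] hom])
  show "x \<in> derived_subspace K V br \<Longrightarrow> C x = \<zero>\<^bsub>V\<^esub>"
    using vanishes_on_derived_subspace[OF lin] C by (simp add: central_homs_def)
qed

text \<open>
  The condition on \<open>A\<close> is \<open>A - E \<in> Centr \<gg>\<close> in disguise.  All terms of the Leibniz rule that
  involve \<open>C\<close> vanish, and the rest is the Leibniz rule for \<open>B\<close> and \<open>E\<close> together with this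
  condition.
\<close>
lemma derivation_from_blocks:
  assumes B: "B \<in> Der" and E: "E \<in> Der" and C: "C \<in> central_homs"
    and A: "A \<in> carrier (hom_space K V V)"
    and AE: "\<And>x y. x \<in> carrier V \<Longrightarrow> y \<in> carrier V \<Longrightarrow> A (br x y) = br (E x) y \<oplus>\<^bsub>V\<^esub> br x (A y)"
  shows "from_blocks A B C E \<in> derivations K H hbr"
proof -
  have C': "C \<in> carrier (hom_space K V V)" "x \<in> carrier V \<Longrightarrow> C x \<in> lie_center V br"
    "x \<in> carrier V \<Longrightarrow> y \<in> carrier V \<Longrightarrow> C (br x y) = \<zero>\<^bsub>V\<^esub>" for x y
    using C by (auto simp: central_homs_def)
  have Cval: "x \<in> carrier V \<Longrightarrow> C x \<in> carrier V"
    "x \<in> carrier V \<Longrightarrow> y \<in> carrier V \<Longrightarrow> C (x \<oplus>\<^bsub>V\<^esub> y) = C x \<oplus>\<^bsub>V\<^esub> C y" for x y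
    using C'(1) by (auto simp: hom_space_carrier_iff)
  have Aval: "x \<in> carrier V \<Longrightarrow> A x \<in> carrier V"
    "x \<in> carrier V \<Longrightarrow> y \<in> carrier V \<Longrightarrow> A (x \<oplus>\<^bsub>V\<^esub> y) = A x \<oplus>\<^bsub>V\<^esub> A y" for x y
    using A by (auto simp: hom_space_carrier_iff)
  interpret A: linear_map K V V A
    by (rule hom_space_linear_map[OF vectorspace_axioms vectorspace_axioms A])
  interpret C: linear_map K V V C
    by (rule hom_space_linear_map[OF vectorspace_axioms vectorspace_axioms C'(1)])
  have Cbr: "br (C x) y = \<zero>\<^bsub>V\<^esub>" "br y (C x) = \<zero>\<^bsub>V\<^esub>"
    if "x \<in> carrier V" "y \<in> carrier V" for x y
    using center_br[OF C'(2)] that by blast+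
  interpret H: lie_algebra K H hbr by (rule semidirect_lie_algebra)
  show ?thesis
  proof (rule H.derivationI[OF from_blocks_hom[OF A derivationD(1)[OF B] C'(1) derivationD(1)[OF E]]])
    fix p q assume "p \<in> carrier H" "q \<in> carrier H"
    then obtain m g n h where p: "p = (m, g)" "m \<in> carrier V" "g \<in> carrier V"
      and q: "q = (n, h)" "n \<in> carrier V" "h \<in> carrier V"
      by (auto simp: direct_sum_simps)
    have Bg: "br (B g) h = \<ominus>\<^bsub>V\<^esub> br h (B g)"
      by (rule br_antisym[OF derivationD(2)[OF B p(3)] q(3)])
    show "from_blocks A B C E (hbr p q)
      = hbr (from_blocks A B C E p) q \<oplus>\<^bsub>H\<^esub> hbr p (from_blocks A B C E q)"
      unfolding p(1) q(1) using p(2,3) q(2,3)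
      by (simp add: from_blocks_def semidirect_br_def direct_sum_simps br_closed Aval Cval
          derivationD(2,5)[OF B] derivationD(2,5)[OF E] AE C'(3) Cbr Bg br_add_left br_add_right
          br_neg module.M.minus_eq module.M.minus_add module.M.a_ac)
  qed
qed

text \<open>
  The sign in the bracket of the semi-direct product is absorbed by antisymmetry:
  \<open>[g, m'] - [g', m] = [g, m'] + [m, g']\<close>.
\<close>
lemma inner_derivation_blocks:
  assumes "m \<in> carrier V" "g \<in> carrier V"
  shows "(\<lambda>q\<in>carrier H. hbr (m, g) q)
    = from_blocks (\<lambda>x\<in>carrier V. br g x) (\<lambda>x\<in>carrier V. br m x) (\<lambda>x\<in>carrier V. \<zero>\<^bsub>V\<^esub>)
        (\<lambda>x\<in>carrier V. br g x)"
  unfolding from_blocks_def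
proof (rule restrict_ext)
  fix q assume "q \<in> carrier H"
  then have "fst q \<in> carrier V" "snd q \<in> carrier V" by (auto simp: direct_sum_simps)
  then show "hbr (m, g) q
      = ((\<lambda>x\<in>carrier V. br g x) (fst q) \<oplus>\<^bsub>V\<^esub> (\<lambda>x\<in>carrier V. br m x) (snd q),
         (\<lambda>x\<in>carrier V. \<zero>\<^bsub>V\<^esub>) (fst q) \<oplus>\<^bsub>V\<^esub> (\<lambda>x\<in>carrier V. br g x) (snd q))"
    using assms br_antisym[of m "snd q"]
    by (simp add: semidirect_br_def split_def br_closed module.M.minus_eq)
qed

text \<open>
  The Leibniz rule is evaluated on the three kinds of pairs of vectors from the summands.  Two of the
  resulting identities concern \<open>C\<close>: it commutes with all \<open>ad g\<close>, and \<open>[C m, n] = [C n, m]\<close>.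
  By the first, the left side of the second is \<open>C [m, n]\<close> and the right side is \<open>- C [m, n]\<close>, so
  \<open>2 C [m, n] = 0\<close>; this is where \<open>2 \<noteq> 0\<close> enters.
\<close>
lemma derivation_blocks:
  assumes two: "\<one>\<^bsub>K\<^esub> \<oplus>\<^bsub>K\<^esub> \<one>\<^bsub>K\<^esub> \<noteq> \<zero>\<^bsub>K\<^esub>"
    and D: "D \<in> derivations K H hbr"
  shows "block fst incl2 D \<in> Der"
    and "block snd incl2 D \<in> Der"
    and "block snd incl1 D \<in> central_homs"
    and "block fst incl1 D \<ominus>\<^bsub>hom_space K V V\<^esub> block snd incl2 D \<in> carrier (centroid K V br)"
proof -
  interpret H: lie_algebra K H hbr by (rule semidirect_lie_algebra)
  interpret Hom: vectorspace K "hom_space K V V" by (rule hom_vectorspace)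
  define A B C E where "A = block fst incl1 D" and "B = block fst incl2 D"
    and "C = block snd incl1 D" and "E = block snd incl2 D"
  note hom = block_hom[OF H.derivationD(1)[OF D], folded A_def B_def C_def E_def]
  have val: "A x \<in> carrier V" "B x \<in> carrier V" "C x \<in> carrier V" "E x \<in> carrier V"
    if "x \<in> carrier V" for x
    using hom that by (auto simp: hom_space_carrier_iff)
  have D1: "D (x, \<zero>\<^bsub>V\<^esub>) = (A x, C x)" and D2: "D (\<zero>\<^bsub>V\<^esub>, x) = (B x, E x)"
    if "x \<in> carrier V" for x
    using that by (simp_all add: A_def B_def C_def E_def block_def)
  have D0: "D (\<zero>\<^bsub>V\<^esub>, \<zero>\<^bsub>V\<^esub>) = (\<zero>\<^bsub>V\<^esub>, \<zero>\<^bsub>V\<^esub>)"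
  proof -
    interpret D: linear_map K H H D
      by (rule hom_space_linear_map[OF H.vectorspace_axioms H.vectorspace_axioms
            H.derivationD(1)[OF D]])
    show ?thesis using D.T0_is_0 by (simp add: direct_sum_simps)
  qed
  have leibniz: "D (hbr p q) = hbr (D p) q \<oplus>\<^bsub>H\<^esub> hbr p (D q)"
    if "p \<in> carrier H" "q \<in> carrier H" for p q
    using H.derivationD(5)[OF D that] .
  note expand = semidirect_br_def direct_sum_simps br_zero br_closed val D0 D1 D2
    module.M.minus_eq module.M.a_inv_zero
  have gg: "B (br g h) = \<ominus>\<^bsub>V\<^esub> br h (B g) \<oplus>\<^bsub>V\<^esub> br g (B h) \<and>
      E (br g h) = br (E g) h \<oplus>\<^bsub>V\<^esub> br g (E h)"
    if "g \<in> carrier V" "h \<in> carrier V" for g h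
    using leibniz[of "(\<zero>\<^bsub>V\<^esub>, g)" "(\<zero>\<^bsub>V\<^esub>, h)"] that by (simp add: expand)
  have gm: "A (br g m) = br (E g) m \<oplus>\<^bsub>V\<^esub> br g (A m) \<and> C (br g m) = br g (C m)"
    if "g \<in> carrier V" "m \<in> carrier V" for g m
    using leibniz[of "(\<zero>\<^bsub>V\<^esub>, g)" "(m, \<zero>\<^bsub>V\<^esub>)"] that by (simp add: expand)
  have mm: "br (C m) n \<oplus>\<^bsub>V\<^esub> \<ominus>\<^bsub>V\<^esub> br (C n) m = \<zero>\<^bsub>V\<^esub>"
    if "m \<in> carrier V" "n \<in> carrier V" for m n
    using leibniz[of "(m, \<zero>\<^bsub>V\<^esub>)" "(n, \<zero>\<^bsub>V\<^esub>)"] that by (simp add: expand)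
  show "B \<in> Der"
  proof (rule derivationI[OF hom(2)])
    fix x y assume "x \<in> carrier V" "y \<in> carrier V"
    then show "B (br x y) = br (B x) y \<oplus>\<^bsub>V\<^esub> br x (B y)"
      using gg[of x y] br_antisym[of "B x" y] val by simp
  qed
  show E: "E \<in> Der" by (rule derivationI[OF hom(4)]) (simp add: gg)
  have C_br: "C (br m n) = \<zero>\<^bsub>V\<^esub>" if mn: "m \<in> carrier V" "n \<in> carrier V" for m n
  proof (rule double_eq_zeroD[OF two])
    interpret C: linear_map K V V C
      by (rule hom_space_linear_map[OF vectorspace_axioms vectorspace_axioms hom(3)])
    show "C (br m n) \<in> carrier V" using mn by (simp add: val br_closed)
    have "br (C m) n = C (br m n)"
    proof -
      have "br (C m) n = \<ominus>\<^bsub>V\<^esub> br n (C m)" by (rule br_antisym[OF val(3)[OF mn(1)] mn(2)])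
      also have "\<dots> = \<ominus>\<^bsub>V\<^esub> C (br n m)" using gm[OF mn(2,1)] by simp
      also have "\<dots> = C (\<ominus>\<^bsub>V\<^esub> br n m)" by (rule C.T_neg[OF br_closed[OF mn(2,1)], symmetric])
      also have "\<dots> = C (br m n)" by (simp only: br_antisym[OF mn])
      finally show ?thesis .
    qed
    moreover have "\<ominus>\<^bsub>V\<^esub> br (C n) m = C (br m n)"
      using br_antisym[OF mn(1) val(3)[OF mn(2)]] gm[OF mn] by simp
    ultimately show "C (br m n) \<oplus>\<^bsub>V\<^esub> C (br m n) = \<zero>\<^bsub>V\<^esub>" using mm[OF mn] by simp
  qed
  have "C m \<in> lie_center V br" if m: "m \<in> carrier V" for m
  proof -
    have "br (C m) x = \<zero>\<^bsub>V\<^esub>" if x: "x \<in> carrier V" for x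
      using br_antisym[OF val(3)[OF m] x] gm[OF x m] C_br[OF x m] module.M.a_inv_zero by simp
    then show ?thesis using val m by (simp add: lie_center_def)
  qed
  then show "C \<in> central_homs" using hom(3) C_br by (simp add: central_homs_def)
  show "A \<ominus>\<^bsub>hom_space K V V\<^esub> E \<in> carrier (centroid K V br)"
  proof (rule centroidI[OF Hom.module.M.minus_closed[OF hom(1,4)]])
    note minus = hom_space_minus_apply[OF vectorspace_axioms vectorspace_axioms _ hom(1,4)]
    fix x y assume xy: "x \<in> carrier V" "y \<in> carrier V"
    have "A (br x y) \<ominus>\<^bsub>V\<^esub> E (br x y) = br x (A y) \<oplus>\<^bsub>V\<^esub> \<ominus>\<^bsub>V\<^esub> br x (E y)"
      using gm[OF xy] gg[OF xy] xy
      by (simp add: val br_closed module.M.minus_eq module.M.minus_add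
          module.M.a_comm[of "br (E x) y" "br x (A y)"] module.M.a_assoc module.M.r_neg2)
    then show "(A \<ominus>\<^bsub>hom_space K V V\<^esub> E) (br x y) = br x ((A \<ominus>\<^bsub>hom_space K V V\<^esub> E) y)"
      using xy by (simp add: minus br_closed val br_add_right br_neg module.M.minus_eq)
  qed
qed

end

section \<open>The first cohomology of the semi-direct product\<close>

context lie_algebra
begin

text \<open>
  The surjection \<open>\<Phi>\<close> sends a derivation with blocks \<open>A, B, C, E\<close> to the classes of \<open>B\<close> and \<open>E\<close>,
  to the map that \<open>C\<close> induces on \<open>\<gg>/[\<gg>, \<gg>]\<close> and to \<open>A - E\<close>.
\<close>
theorem H1_adjoint_semidirect:
  assumes two: "\<one>\<^bsub>K\<^esub> \<oplus>\<^bsub>K\<^esub> \<one>\<^bsub>K\<^esub> \<noteq> \<zero>\<^bsub>K\<^esub>"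
  shows "vs_isomorphic K (H1_adjoint K H hbr)
    (direct_sum
      (direct_sum
        (direct_sum (H1_adjoint K V br) (H1_adjoint K V br))
        (hom_space K (quot_space V (derived_subspace K V br)) (V\<lparr>carrier := lie_center V br\<rparr>)))
      (centroid K V br))"
    (is "vs_isomorphic K _ ?target")
proof -
  interpret H: lie_algebra K H hbr by (rule semidirect_lie_algebra)
  interpret Hom: vectorspace K "hom_space K V V" by (rule hom_vectorspace)
  interpret Q: vs_quotient K Der_space Inn by (rule H1_quotient)
  interpret HQ: vs_quotient K H.Der_space H.Inn by (rule H.H1_quotient)
  interpret Ab: vs_quotient K V "derived_subspace K V br" by (rule abelianization_quotient)
  let ?Z = "V\<lparr>carrier := lie_center V br\<rparr>"
  have Z: "vectorspace K ?Z" by (rule subspace_is_vs[OF center_subspace])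
  let ?B = "block fst incl2" and ?C = "block snd incl1" and ?E = "block snd incl2"
  let ?phi = "\<lambda>D. block fst incl1 D \<ominus>\<^bsub>hom_space K V V\<^esub> block snd incl2 D"
  note blocks = derivation_blocks[OF two]
  have lin_B: "linear_map K H.Der_space Der_space ?B"
    by (rule linear_map_restrict[OF block_linears(2) H.derivations_subspace derivations_subspace
          blocks(1)])
  have lin_E: "linear_map K H.Der_space Der_space ?E"
    by (rule linear_map_restrict[OF block_linears(4) H.derivations_subspace derivations_subspace
          blocks(2)])
  have lin_phi: "linear_map K H.Der_space (centroid K V br) ?phi"
    using linear_map_restrict[OF linear_map_diff[OF block_linears(1,4)] H.derivations_subspace
        centroid_subspace blocks(4)]
    by (simp add: centroid_def)
  have lin_C: "linear_map K H.Der_space (hom_space K V ?Z) ?C"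
  proof -
    interpret C: linear_map K "hom_space K H H" "hom_space K V V" ?C by (rule block_linears(3))
    show ?thesis
      by (rule linear_mapI[OF H.Der_vectorspace hom_space_vectorspace[OF vectorspace_axioms Z]
            central_homsD(1)[OF blocks(3)]])
         (use C.T_add C.T_smult H.derivationD(1) in \<open>simp_all add: hom_space_simps\<close>)
  qed
  have lin_Cbar: "linear_map K H.Der_space (hom_space K (quot_space V (derived_subspace K V br)) ?Z)
      (\<lambda>D. Ab.descend (?C D))"
    by (rule Ab.descend_linear[OF lin_C Z]) (simp add: central_homsD(3)[OF blocks(3)])
  define \<Phi> where "\<Phi> D = (((Q.proj (?B D), Q.proj (?E D)), Ab.descend (?C D)), ?phi D)" for D
  have lin: "linear_map K H.Der_space ?target \<Phi>"
    unfolding \<Phi>_def H1_adjoint_def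
    by (intro linear_map_Pair linear_map_compose[OF lin_B Q.proj_linear]
        linear_map_compose[OF lin_E Q.proj_linear] lin_Cbar lin_phi)
  have ker: "\<Phi> D = \<zero>\<^bsub>?target\<^esub> \<longleftrightarrow> D \<in> H.Inn" if "D \<in> carrier H.Der_space" for D
  proof -
    have D: "D \<in> derivations K H hbr" using that by simp
    note hom = block_hom[OF H.derivationD(1)[OF D]]
    have "\<Phi> D = \<zero>\<^bsub>?target\<^esub> \<longleftrightarrow> ?B D \<in> Inn \<and> ?E D \<in> Inn
        \<and> Ab.descend (?C D) = \<zero>\<^bsub>hom_space K (quot_space V (derived_subspace K V br)) ?Z\<^esub>
        \<and> ?phi D = \<zero>\<^bsub>hom_space K V V\<^esub>"
      using Q.proj_eq_zero_iff[of "?B D"] Q.proj_eq_zero_iff[of "?E D"] blocks(1,2)[OF D]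
      by (simp add: \<Phi>_def direct_sum_simps H1_adjoint_def centroid_def)
    also have "?phi D = \<zero>\<^bsub>hom_space K V V\<^esub> \<longleftrightarrow> block fst incl1 D = ?E D"
      using hom(1,4) by (rule Hom.module.M.minus_other_side)
    also have "Ab.descend (?C D) = \<zero>\<^bsub>hom_space K (quot_space V (derived_subspace K V br)) ?Z\<^esub>
        \<longleftrightarrow> ?C D = (\<lambda>x\<in>carrier V. \<zero>\<^bsub>V\<^esub>)"
    proof -
      have val: "Ab.descend (?C D) (Ab.proj x) = ?C D x" if "x \<in> carrier V" for x
        using Ab.descend_proj[OF central_homsD(2)[OF blocks(3)[OF D]] _ that]
          central_homsD(3)[OF blocks(3)[OF D]] by simp
      show ?thesis
      proof
        assume "Ab.descend (?C D) = \<zero>\<^bsub>hom_space K (quot_space V (derived_subspace K V br)) ?Z\<^esub>"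
        then have "?C D x = \<zero>\<^bsub>V\<^esub>" if "x \<in> carrier V" for x
          using val[OF that] that by (simp add: hom_space_simps Ab.quot_carrier)
        then show "?C D = (\<lambda>x\<in>carrier V. \<zero>\<^bsub>V\<^esub>)"
          by (intro extensionalityI[of _ "carrier V"]) (simp_all add: block_def)
      next
        assume "?C D = (\<lambda>x\<in>carrier V. \<zero>\<^bsub>V\<^esub>)"
        then show "Ab.descend (?C D)
            = \<zero>\<^bsub>hom_space K (quot_space V (derived_subspace K V br)) ?Z\<^esub>"
          using val unfolding hom_space_simps
          by (intro extensionalityI[of _ "carrier (quot_space V (derived_subspace K V br))"])
             (auto simp: Ab.quot_carrier Ab.descend_def)
      qed
    qed
    also have "?B D \<in> Inn \<and> ?E D \<in> Inn \<and> ?C D = (\<lambda>x\<in>carrier V. \<zero>\<^bsub>V\<^esub>)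
        \<and> block fst incl1 D = ?E D \<longleftrightarrow> D \<in> H.Inn"
    proof
      assume asm: "?B D \<in> Inn \<and> ?E D \<in> Inn \<and> ?C D = (\<lambda>x\<in>carrier V. \<zero>\<^bsub>V\<^esub>)
        \<and> block fst incl1 D = ?E D"
      then obtain m g where m: "m \<in> carrier V" "?B D = (\<lambda>x\<in>carrier V. br m x)"
        and g: "g \<in> carrier V" "?E D = (\<lambda>x\<in>carrier V. br g x)"
        by (auto simp: inner_derivations_def)
      have "D = (\<lambda>q\<in>carrier H. hbr (m, g) q)"
        using hom_eq_from_blocks[OF H.derivationD(1)[OF D]] asm m(2) g(2)
          inner_derivation_blocks[OF m(1) g(1)] by simp
      moreover have "(m, g) \<in> carrier H" using m g by (simp add: direct_sum_simps)
      ultimately show "D \<in> H.Inn" unfolding inner_derivations_def by blast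
    next
      assume "D \<in> H.Inn"
      then obtain m g where m: "m \<in> carrier V" and g: "g \<in> carrier V"
        and Deq: "D = (\<lambda>q\<in>carrier H. hbr (m, g) q)"
        by (auto simp: inner_derivations_def direct_sum_simps)
      have adh: "(\<lambda>x\<in>carrier V. br y x) \<in> carrier (hom_space K V V)" if "y \<in> carrier V" for y
        using that by (intro restrict_in_hom_space[OF vectorspace_axioms])
          (simp_all add: br_closed br_add_right br_smult_right)
      have zero: "(\<lambda>x\<in>carrier V. \<zero>\<^bsub>V\<^esub>) \<in> carrier (hom_space K V V)"
        using Hom.module.M.zero_closed by (simp add: hom_space_simps)
      show "?B D \<in> Inn \<and> ?E D \<in> Inn \<and> ?C D = (\<lambda>x\<in>carrier V. \<zero>\<^bsub>V\<^esub>) \<and> block fst incl1 D = ?E D"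
        using m g unfolding Deq inner_derivation_blocks[OF m g]
        by (simp add: block_from_blocks adh zero inner_derivations_def)
    qed
    finally show ?thesis .
  qed
  have surj: "\<exists>D\<in>carrier H.Der_space. \<Phi> D = y" if y: "y \<in> carrier ?target" for y
  proof -
    obtain P R F \<phi> where yeq: "y = (((P, R), F), \<phi>)" by (metis prod.exhaust)
    with y have P: "P \<in> carrier (quot_space Der_space Inn)"
      and R: "R \<in> carrier (quot_space Der_space Inn)"
      and F: "F \<in> carrier (hom_space K (quot_space V (derived_subspace K V br)) ?Z)"
      and \<phi>: "\<phi> \<in> carrier (centroid K V br)"
      by (auto simp: direct_sum_simps H1_adjoint_def)
    obtain B E where B: "B \<in> Der" "P = Q.proj B" and E: "E \<in> Der" "R = Q.proj E"
      using P R by (auto simp: Q.quot_carrier)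
    define C where "C = (\<lambda>x\<in>carrier V. F (Ab.proj x))"
    \<comment> \<open>The block \<open>A\<close> is forced by the last component \<open>A - E = \<phi>\<close>.\<close>
    define A where "A = E \<oplus>\<^bsub>hom_space K V V\<^esub> \<phi>"
    interpret F: linear_map K "quot_space V (derived_subspace K V br)" ?Z F
      by (rule hom_space_linear_map[OF Ab.quot_vectorspace Z F])
    have Fproj: "F (Ab.proj x) \<in> lie_center V br" if "x \<in> carrier V" for x
      using F.T_im that by (simp add: Ab.quot_carrier)
    have C: "C \<in> central_homs"
    proof -
      have "C \<in> carrier (hom_space K V V)"
        unfolding C_def
      proof (rule restrict_in_hom_space[OF vectorspace_axioms])
        show "F (Ab.proj x) \<in> carrier V" if "x \<in> carrier V" for x
          using Fproj[OF that] by (simp add: lie_center_def)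
        show "F (Ab.proj (x \<oplus>\<^bsub>V\<^esub> y)) = F (Ab.proj x) \<oplus>\<^bsub>V\<^esub> F (Ab.proj y)"
          if "x \<in> carrier V" "y \<in> carrier V" for x y
          using F.T_add[of "Ab.proj x" "Ab.proj y"] that by (simp add: Ab.proj_add Ab.quot_carrier)
        show "F (Ab.proj (c \<odot>\<^bsub>V\<^esub> x)) = c \<odot>\<^bsub>V\<^esub> F (Ab.proj x)"
          if "c \<in> carrier K" "x \<in> carrier V" for c x
          using F.T_smult[of c "Ab.proj x"] that by (simp add: Ab.proj_smult Ab.quot_carrier)
      qed
      moreover have "F (Ab.proj (br x y)) = \<zero>\<^bsub>V\<^esub>" if "x \<in> carrier V" "y \<in> carrier V" for x y
      proof -
        have "br x y \<in> derived_subspace K V br"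
          unfolding derived_subspace_def using that br_closed
          by (intro subsetD[OF in_own_span]) auto
        then have "Ab.proj (br x y) = \<zero>\<^bsub>quot_space V (derived_subspace K V br)\<^esub>"
          using Ab.proj_eq_zero_iff br_closed that by simp
        then show ?thesis using F.T0_is_0 by simp
      qed
      ultimately show ?thesis using Fproj br_closed by (auto simp: central_homs_def C_def)
    qed
    have A: "A \<in> carrier (hom_space K V V)"
      unfolding A_def by (intro Hom.module.M.a_closed derivationD(1)[OF E(1)] centroidD(1)[OF \<phi>])
    let ?D = "from_blocks A B C E"
    have D: "?D \<in> derivations K H hbr"
      by (rule derivation_from_blocks[OF B(1) E(1) C A])
         (simp add: A_def hom_space_simps br_closed derivationD(2,5)[OF E(1)] centroidD(2,5)[OF \<phi>]
           br_add_right module.M.a_assoc)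
    have "C \<in> carrier (hom_space K V V)" using C by (simp add: central_homs_def)
    note block_D = block_from_blocks[OF A derivationD(1)[OF B(1)] this derivationD(1)[OF E(1)]]
    have "?phi ?D = \<phi>"
      unfolding block_D unfolding A_def
      using derivationD(1)[OF E(1)] centroidD(1)[OF \<phi>]
      by (simp add: Hom.module.M.minus_eq Hom.module.M.a_comm[of E \<phi>] Hom.module.M.a_assoc
          Hom.module.M.r_neg)
    moreover have "Ab.descend C = F"
    proof (rule hom_space_eqI[OF Ab.descend_hom[OF central_homsD(2)[OF C]] F])
      show "C x = \<zero>\<^bsub>?Z\<^esub>" if "x \<in> derived_subspace K V br" for x
        using central_homsD(3)[OF C that] by simp
      fix U assume "U \<in> carrier (quot_space V (derived_subspace K V br))"
      then obtain x where x: "x \<in> carrier V" "U = Ab.proj x" by (auto simp: Ab.quot_carrier)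
      then show "Ab.descend C U = F U"
        using Ab.descend_proj[OF central_homsD(2)[OF C] _ x(1)] central_homsD(3)[OF C]
        by (simp add: C_def)
    qed
    ultimately have "\<Phi> ?D = y" by (simp add: \<Phi>_def block_D yeq B(2) E(2))
    then show ?thesis using D by auto
  qed
  show ?thesis
    unfolding H1_adjoint_def[of K H]
    by (rule HQ.quot_isomorphic[OF lin ker surj])
qed

end

theorem theorem2p5:
  fixes \<gg> :: "(complex, 'v, 'm) module_scheme"
    and br :: "'v \<Rightarrow> 'v \<Rightarrow> 'v"
  assumes "lie_algebra class_ring \<gg> br"
    and "vectorspace.fin_dim class_ring \<gg>"
  shows "vs_isomorphic class_ring
    (H1_adjoint class_ring (direct_sum \<gg> \<gg>) (semidirect_br \<gg> br))
    (direct_sum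
      (direct_sum
        (direct_sum (H1_adjoint class_ring \<gg> br) (H1_adjoint class_ring \<gg> br))
        (hom_space class_ring
          (quot_space \<gg> (derived_subspace class_ring \<gg> br))
          (\<gg>\<lparr>carrier := lie_center \<gg> br\<rparr>)))
      (centroid class_ring \<gg> br))"
  using lie_algebra.H1_adjoint_semidirect[OF assms(1)] by simp

end
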